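(* Suppose $f_1,\dots,f_n$ satisfy the strong convexity and smoothness assumption (S) of the context, and consider the stochastic algorithm described in the context with constant step size $\eta>0$, epoch length $m\ge1$ and the following end-of-epoch rule (option 1): $\tilde w_k=w_m$. Suppose the variance condition (V) of the context holds with constant $\alpha>0$. Let $w_*$ be the minimizer of $F$, and let $$\gamma=\big(1-2\eta\mu(1-\eta L(2\alpha+1))\big)^m+\frac{2\alpha\eta L^2}{\mu(1-\eta L(2\alpha+1))}.$$ Then for every epoch $k\ge1$, $$\mathbb{E}\|\tilde w_k-w_*\|^2\le\gamma\,\|\tilde w_{k-1}-w_*\|^2,$$ where $\mathbb{E}$ is the expectation over the random choices made in epoch $k$, conditional on the history before epoch $k$.
   Context: Let $F(w)=\frac1n\sum_{i=1}^n f_i(w)$, $w\in\mathbb{R}^d$, with $f_i:\mathbb{R}^d\to\mathbb{R}$ twice continuously differentiable. $\|\cdot\|$ is the Euclidean norm. Assumption (S): for each $i$ there is $\mu_i>0$ with $f_i(w)\ge f_i(z)+\nabla f_i(z)^T(w-z)+\frac{\mu_i}{2}\|z-w\|^2$ for all $w,z\in\mathbb{R}^d$, and there is $L>0$ with $\|\nabla f_i(w)-\nabla f_i(z)\|\le L\|w-z\|$ for all $i$ and all $w,z$. Put $\mu=\min_i\mu_i$, so $F$ is $\mu$-strongly convex with $L$-Lipschitz gradient. Algorithm: start from $\tilde w_0\in\mathbb{R}^d$. In epoch $k=1,2,\dots$: set $\tilde w=\tilde w_{k-1}$, $\tilde g=\nabla F(\tilde w)$, $w_0=\tilde w$. Real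 $d\times d$ matrices $\tilde A^{k-1}_1,\dots,\tilde A^{k-1}_n$, determined by the history before epoch $k$, are given, with mean $\tilde A^{k-1}=\frac1n\sum_i\tilde A^{k-1}_i$. For $t=1,\dots,m$: pick $i_t\in\{1,\dots,n\}$ uniformly at random, independently of the past, and set $w_t=w_{t-1}-\eta v_t$, where $$v_t=\nabla f_{i_t}(w_{t-1})-\nabla f_{i_t}(\tilde w)+\tilde g+(\tilde A^{k-1}-\tilde A^{k-1}_{i_t})(w_{t-1}-\tilde w).$$ Finally $\tilde w_k$ is chosen by the end-of-epoch rule. Condition (V) with constant $\alpha>0$: for all epochs $k$ and all $t$, $$\mathbb{E}\big[\|\nabla f_{i_t}(w_{t-1})-\nabla f_{i_t}(\tilde w)-\tilde A^{k-1}_{i_t}(w_{t-1}-\tilde w)\|^2\big]\le\alpha\,\mathbb{E}\big[\|\nabla f_{i_t}(w_{t-1})-\nabla f_{i_t}(\tilde w)\|^2\big],$$ where here $\mathbb{E}$ is the expectation over $i_t$ conditional on the past (in particular on $w_{t-1}$ and $\tilde w$).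
   Formalization: The step size is additionally assumed to satisfy 1 − ηL(2α+1) > 0; otherwise γ can be undefined or negative and the claim fails (n=d=m=1, f(w)=w²/2, zero matrix, α=1, η=1/2 gives γ=−1/2). *)

theory Defs
  imports "HOL-Probability.Probability"
begin

definition grad :: "('a::real_inner \<Rightarrow> real) \<Rightarrow> 'a \<Rightarrow> 'a" where
  "grad f x = (THE g. GDERIV f x :> g)"

definition twice_continuously_differentiable :: "(real^'d \<Rightarrow> real) \<Rightarrow> bool" where
  "twice_continuously_differentiable f \<longleftrightarrow>
     (\<exists>(G :: real^'d \<Rightarrow> real^'d) (H :: real^'d \<Rightarrow> real^'d^'d).
        (\<forall>x. GDERIV f x :> G x) \<and>
        (\<forall>x. (G has_derivative (\<lambda>h. H x *v h)) (at x)) \<and>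
        continuous_on UNIV H)"

definition mean :: "nat \<Rightarrow> (nat \<Rightarrow> 'a::real_vector) \<Rightarrow> 'a" where
  "mean n a = (1 / real n) *\<^sub>R (\<Sum>i=1..n. a i)"

definition objective :: "nat \<Rightarrow> (nat \<Rightarrow> 'a \<Rightarrow> real) \<Rightarrow> 'a \<Rightarrow> real" where
  "objective n f w = mean n (\<lambda>i. f i w)"

text \<open>The smoothness half is stated through \<open>lipschitz_on\<close> with respect to the Euclidean distance.\<close>

definition strongly_convex_and_smooth ::
  "nat \<Rightarrow> (nat \<Rightarrow> real^'d \<Rightarrow> real) \<Rightarrow> (nat \<Rightarrow> real) \<Rightarrow> real \<Rightarrow> bool" where
  "strongly_convex_and_smooth n f \<mu>s L \<longleftrightarrow>
     (\<forall>i\<in>{1..n}. \<mu>s i > 0 \<and>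
        (\<forall>w z. f i w \<ge> f i z + grad (f i) z \<bullet> (w - z) + \<mu>s i / 2 * (norm (z - w))\<^sup>2)) \<and>
     L > 0 \<and>
     (\<forall>i\<in>{1..n}. L-lipschitz_on UNIV (grad (f i)))"

text \<open>The direction \<open>v\<^sub>t\<close> taken at the inner iterate \<open>w\<close> when the index \<open>i\<close> is drawn;
  \<open>z\<close> is the snapshot of the current epoch and \<open>A\<close> its family of matrices.\<close>

definition direction ::
  "nat \<Rightarrow> (nat \<Rightarrow> real^'d \<Rightarrow> real) \<Rightarrow> (nat \<Rightarrow> real^'d^'d) \<Rightarrow> real^'d \<Rightarrow> nat \<Rightarrow> real^'d \<Rightarrow> real^'d"
  where
  "direction n f A z i w =
     grad (f i) w - grad (f i) z + grad (objective n f) z + (mean n A - A i) *v (w - z)"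

text \<open>\<open>H k t\<close> is the sigma-algebra of the history up to and including step \<open>t\<close> of epoch \<open>k\<close>;
  \<open>H k 0\<close> is the history before epoch \<open>k\<close>. It may be larger than the one generated by
  the drawn indices, so that the matrices may also depend on further randomness
  that precedes the epoch.\<close>

definition history :: "'w measure \<Rightarrow> nat \<Rightarrow> (nat \<Rightarrow> nat \<Rightarrow> 'w measure) \<Rightarrow> bool" where
  "history M m H \<longleftrightarrow>
     (\<forall>k\<ge>1. \<forall>t\<le>m. subalgebra M (H k t)) \<and>
     (\<forall>k\<ge>1. \<forall>t\<in>{1..m}. sets (H k (t - 1)) \<subseteq> sets (H k t)) \<and>
     (\<forall>k\<ge>1. sets (H k m) \<subseteq> sets (H (k + 1) 0))"

definition uniform_independent_of :: "'w measure \<Rightarrow> 'w measure \<Rightarrow> nat \<Rightarrow> ('w \<Rightarrow> nat) \<Rightarrow> bool" where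
  "uniform_independent_of M G n X \<longleftrightarrow>
     X \<in> measurable M (count_space {1..n}) \<and>
     distr M (count_space {1..n}) X = uniform_count_measure {1..n} \<and>
     prob_space.indep_set M (sets G) (sets (vimage_algebra (space M) X (count_space {1..n})))"

text \<open>\<open>idx k t\<close> is the index \<open>i\<^sub>t\<close> drawn in epoch \<open>k\<close>, \<open>A k i\<close> is the matrix with superscript \<open>k\<close>
  (used in epoch \<open>k + 1\<close>), \<open>w k t\<close> is the iterate \<open>w\<^sub>t\<close> of epoch \<open>k\<close>, and \<open>snap k\<close> is the
  snapshot after epoch \<open>k\<close>, here the last inner iterate.\<close>

definition svrg_run ::
  "'w measure \<Rightarrow> nat \<Rightarrow> (nat \<Rightarrow> real^'d \<Rightarrow> real) \<Rightarrow> real \<Rightarrow> nat \<Rightarrow> real^'d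
   \<Rightarrow> (nat \<Rightarrow> nat \<Rightarrow> 'w measure) \<Rightarrow> (nat \<Rightarrow> nat \<Rightarrow> 'w \<Rightarrow> nat) \<Rightarrow> (nat \<Rightarrow> nat \<Rightarrow> 'w \<Rightarrow> real^'d^'d)
   \<Rightarrow> (nat \<Rightarrow> nat \<Rightarrow> 'w \<Rightarrow> real^'d) \<Rightarrow> (nat \<Rightarrow> 'w \<Rightarrow> real^'d) \<Rightarrow> bool" where
  "svrg_run M n f \<eta> m w0 H idx A w snap \<longleftrightarrow>
     history M m H \<and>
     (\<forall>k\<ge>1. \<forall>i\<in>{1..n}. A (k - 1) i \<in> borel_measurable (H k 0)) \<and>
     (\<forall>k\<ge>1. \<forall>t\<in>{1..m}. uniform_independent_of M (H k (t - 1)) n (idx k t) \<and>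
        idx k t \<in> measurable (H k t) (count_space {1..n})) \<and>
     (\<forall>\<omega>\<in>space M. snap 0 \<omega> = w0 \<and>
        (\<forall>k\<ge>1. w k 0 \<omega> = snap (k - 1) \<omega> \<and>
           (\<forall>t\<in>{1..m}. w k t \<omega> = w k (t - 1) \<omega> -
              \<eta> *\<^sub>R direction n f (\<lambda>i. A (k - 1) i \<omega>) (snap (k - 1) \<omega>) (idx k t \<omega>) (w k (t - 1) \<omega>)) \<and>
           snap k \<omega> = w k m \<omega>))"

text \<open>\<open>nn_cond_exp\<close> is the conditional expectation of a nonnegative random variable; unlike
  \<open>real_cond_exp\<close> it needs no integrability assumption.\<close>

definition variance_condition ::
  "'w measure \<Rightarrow> (nat \<Rightarrow> real^'d \<Rightarrow> real) \<Rightarrow> nat \<Rightarrow> real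
   \<Rightarrow> (nat \<Rightarrow> nat \<Rightarrow> 'w measure) \<Rightarrow> (nat \<Rightarrow> nat \<Rightarrow> 'w \<Rightarrow> nat) \<Rightarrow> (nat \<Rightarrow> nat \<Rightarrow> 'w \<Rightarrow> real^'d^'d)
   \<Rightarrow> (nat \<Rightarrow> nat \<Rightarrow> 'w \<Rightarrow> real^'d) \<Rightarrow> (nat \<Rightarrow> 'w \<Rightarrow> real^'d) \<Rightarrow> bool" where
  "variance_condition M f m \<alpha> H idx A w snap \<longleftrightarrow>
     (\<forall>k\<ge>1. \<forall>t\<in>{1..m}. AE \<omega> in M.
        nn_cond_exp M (H k (t - 1))
          (\<lambda>\<omega>. ennreal ((norm (grad (f (idx k t \<omega>)) (w k (t - 1) \<omega>) - grad (f (idx k t \<omega>)) (snap (k - 1) \<omega>)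
             - A (k - 1) (idx k t \<omega>) \<omega> *v (w k (t - 1) \<omega> - snap (k - 1) \<omega>)))\<^sup>2)) \<omega>
        \<le> ennreal \<alpha> * nn_cond_exp M (H k (t - 1))
          (\<lambda>\<omega>. ennreal ((norm (grad (f (idx k t \<omega>)) (w k (t - 1) \<omega>) - grad (f (idx k t \<omega>)) (snap (k - 1) \<omega>)))\<^sup>2)) \<omega>)"

end

theory Submission
  imports Defs
begin

text \<open>
  Fix an epoch with snapshot \<open>z\<close>, and write \<open>g\<^sub>i\<close> for the gradient of \<open>f\<^sub>i\<close>, \<open>G\<close> for the mean
  of the \<open>g\<^sub>i\<close>, and \<open>x\<close> for the current inner iterate.  With
  \<open>e\<^sub>i = g\<^sub>i x - g\<^sub>i z - A\<^sub>i (x - z)\<close> the direction taken for index \<open>i\<close> is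
  \<open>G x + (e\<^sub>i - mean e)\<close>.  It is therefore unbiased, and since centring a vector can only lower its
  second moment, its mean square is at most \<open>\<parallel>G x\<parallel>\<^sup>2 + mean \<parallel>e\<parallel>\<^sup>2\<close>.  The variance condition
  replaces \<open>mean \<parallel>e\<parallel>\<^sup>2\<close> by \<open>\<alpha>\<close> times the mean of \<open>\<parallel>g\<^sub>i x - g\<^sub>i z\<parallel>\<^sup>2\<close>, which is split at the
  minimizer.

  All quadratic terms at \<open>x\<close> are then compared with the single number
  \<open>S = \<langle>G x, x - w\<^sub>*\<rangle>\<close>.  Cocoercivity, in the form
  \<open>\<parallel>g\<^sub>i x - g\<^sub>i y\<parallel>\<^sup>2 \<le> 2 L \<langle>g\<^sub>i x - g\<^sub>i y, x - y\<rangle>\<close>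
  (\<open>lipschitz_subgradient_cocoercive\<close>), bounds them above by multiples of \<open>S\<close>; their total is
  outweighed by the descent term \<open>- 2 \<eta> S\<close> because \<open>\<eta> L (2 \<alpha> + 1) < 1\<close>.  Strong monotonicity
  bounds \<open>S\<close> below by \<open>\<mu> \<parallel>x - w\<^sub>*\<parallel>\<^sup>2\<close>.  The result (\<open>svrg_step_mean_bound\<close>) is an affine recursion
  for the expected squared distance: a factor \<open>q\<close>, plus \<open>c\<close> times the squared distance of the
  snapshot.

  The index is independent of the past and uniform, so conditioning on the past amounts to
  averaging over the index with everything else held fixed (\<open>nn_cond_exp_uniform_index\<close>).  This
  moves the variance condition into the deterministic step bound, and the step bound back to the
  random run.  The tower property then iterates the recursion over the epoch
  (\<open>nn_cond_exp_recursion_bound\<close>); the geometric series of the terms in \<open>c\<close> is dominated by the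
  second summand of \<open>\<gamma>\<close>.
\<close>

section \<open>Means of finite families\<close>

lemma mean_add: "mean n (\<lambda>i. a i + b i) = mean n a + mean n b"
  by (simp add: mean_def sum.distrib scaleR_add_right)

lemma mean_diff: "mean n (\<lambda>i. a i - b i) = mean n a - mean n b"
  by (simp add: mean_def sum_subtractf scaleR_diff_right)

lemma mean_const: "n \<ge> 1 \<Longrightarrow> mean n (\<lambda>i. c) = c"
  by (simp add: mean_def sum_constant_scaleR del: sum_constant)

lemma mean_linear: "linear h \<Longrightarrow> mean n (\<lambda>i. h (a i)) = h (mean n a)"
  by (simp add: mean_def linear_cmul linear_sum)

lemma mean_cmult: "mean n (\<lambda>i. c * a i) = c * (mean n a :: real)"
  by (simp add: mean_def sum_distrib_left)

lemma mean_inner: "mean n (\<lambda>i. a i \<bullet> y) = mean n a \<bullet> y"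
  by (simp add: mean_def inner_sum_left)

lemma mean_mono:
  fixes a b :: "nat \<Rightarrow> real"
  shows "(\<And>i. i \<in> {1..n} \<Longrightarrow> a i \<le> b i) \<Longrightarrow> mean n a \<le> mean n b"
  unfolding mean_def real_scaleR_def by (intro mult_left_mono sum_mono) auto

lemma mean_nonneg:
  fixes a :: "nat \<Rightarrow> real"
  shows "(\<And>i. i \<in> {1..n} \<Longrightarrow> 0 \<le> a i) \<Longrightarrow> 0 \<le> mean n a"
  unfolding mean_def real_scaleR_def by (intro mult_nonneg_nonneg sum_nonneg) auto

lemma mean_matrix_vector_mult:
  "mean n (\<lambda>i. A i *v y) = mean n A *v (y :: real^'d)"
  by (rule mean_linear[of "\<lambda>B. B *v y"])
     (auto intro!: linearI simp: matrix_vector_mult_add_rdistrib scaleR_matrix_vector_assoc)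

lemma mean_norm_sq_shift:
  fixes a :: "nat \<Rightarrow> 'a::real_inner"
  assumes "n \<ge> 1"
  shows "mean n (\<lambda>i. (norm (a i + c))\<^sup>2) = mean n (\<lambda>i. (norm (a i))\<^sup>2) + 2 * (mean n a \<bullet> c) + (norm c)\<^sup>2"
proof -
  have "(norm (a i + c))\<^sup>2 = (norm (a i))\<^sup>2 + 2 * (a i \<bullet> c) + (norm c)\<^sup>2" for i
    by (simp add: power2_norm_eq_inner inner_add_left inner_add_right inner_commute)
  then show ?thesis
    using assms by (simp add: mean_add mean_cmult mean_inner mean_const)
qed

lemma norm_mean_sq_le:
  fixes a :: "nat \<Rightarrow> 'a::real_inner"
  assumes "n \<ge> 1"
  shows "(norm (mean n a))\<^sup>2 \<le> mean n (\<lambda>i. (norm (a i))\<^sup>2)"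
proof -
  have "0 \<le> mean n (\<lambda>i. (norm (a i + - mean n a))\<^sup>2)"
    by (rule mean_nonneg) simp
  then show ?thesis
    unfolding mean_norm_sq_shift[OF assms] by (simp add: power2_norm_eq_inner)
qed

text \<open>Expanding the square makes the cross term with \<open>c\<close> vanish, because \<open>e i - mean n e\<close> has mean
  zero; what remains besides \<open>c\<close> is the variance of \<open>e\<close>, which is at most its second moment.\<close>

lemma mean_norm_sq_recentre_le:
  fixes e :: "nat \<Rightarrow> 'a::real_inner"
  assumes "n \<ge> 1"
  shows "mean n (\<lambda>i. (norm (c + (e i - mean n e)))\<^sup>2) \<le> (norm c)\<^sup>2 + mean n (\<lambda>i. (norm (e i))\<^sup>2)"
proof -
  have "mean n (\<lambda>i. (norm (e i + (c - mean n e)))\<^sup>2)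
      = (norm c)\<^sup>2 + mean n (\<lambda>i. (norm (e i))\<^sup>2) - (norm (mean n e))\<^sup>2"
    unfolding mean_norm_sq_shift[OF assms]
    by (simp add: power2_norm_eq_inner inner_diff_left inner_diff_right inner_commute)
  then have "mean n (\<lambda>i. (norm (e i + (c - mean n e)))\<^sup>2) \<le> (norm c)\<^sup>2 + mean n (\<lambda>i. (norm (e i))\<^sup>2)"
    by simp
  then show ?thesis by (simp add: add.commute add_diff_eq)
qed

section \<open>Gradients\<close>

lemma GDERIV_unique:
  assumes "GDERIV f x :> a" "GDERIV f x :> b"
  shows "a = b"
proof -
  have "(\<lambda>h. h \<bullet> a) = (\<lambda>h. h \<bullet> b)"
    using assms has_derivative_unique unfolding gderiv_def by blast
  then have "h \<bullet> (a - b) = 0" for h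
    by (metis inner_diff_right right_minus_eq)
  from this[of "a - b"] show ?thesis by simp
qed

lemma grad_eqI: "GDERIV f x :> g \<Longrightarrow> grad f x = g"
  unfolding grad_def by (rule the_equality) (auto dest: GDERIV_unique)

lemma GDERIV_grad:
  "twice_continuously_differentiable f \<Longrightarrow> GDERIV f x :> grad f x"
  unfolding twice_continuously_differentiable_def by (metis grad_eqI)

lemma GDERIV_objective:
  assumes "\<And>i. i \<in> {1..n} \<Longrightarrow> GDERIV (f i) x :> g i"
  shows "GDERIV (objective n f) x :> mean n g"
proof -
  have "((\<lambda>w. (1 / real n) *\<^sub>R (\<Sum>i=1..n. f i w)) has_derivative
         (\<lambda>h. (1 / real n) *\<^sub>R (\<Sum>i=1..n. h \<bullet> g i))) (at x)"
    using assms unfolding gderiv_def by (intro derivative_intros) auto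
  then show ?thesis
    unfolding gderiv_def objective_def[abs_def] mean_def by (simp add: inner_sum_right)
qed

lemma grad_objective:
  assumes "\<And>i. i \<in> {1..n} \<Longrightarrow> GDERIV (f i) x :> grad (f i) x"
  shows "grad (objective n f) x = mean n (\<lambda>i. grad (f i) x)"
  by (rule grad_eqI) (rule GDERIV_objective[OF assms])

lemma GDERIV_minimum_eq_0:
  assumes "GDERIV f x :> g" "\<And>z. f x \<le> f z"
  shows "g = 0"
proof -
  have "(\<lambda>h. h \<bullet> g) = (\<lambda>h. 0)"
    by (rule differential_zero_maxmin[of x UNIV f]) (use assms in \<open>auto simp: gderiv_def\<close>)
  then have "g \<bullet> g = 0" by meson
  then show ?thesis by simp
qed

section \<open>Cocoercivity and strong monotonicity\<close>

text \<open>Move from \<open>x\<close> against \<open>D = g x - g y\<close> to \<open>u = x - D / (2 L)\<close>.  The function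
  \<open>h v = f v - g y \<bullet> v\<close> is smallest at \<open>y\<close>, so \<open>h x - h y \<ge> h x - h u \<ge> (g u - g y) \<bullet> (x - u)\<close>,
  and the Lipschitz bound keeps \<open>g u - g y\<close> within half the length of \<open>D\<close> from \<open>D\<close>.  Adding the
  resulting estimate to the one with \<open>x\<close> and \<open>y\<close> exchanged cancels the function values.\<close>

lemma lipschitz_subgradient_cocoercive:
  fixes f :: "'a::real_inner \<Rightarrow> real"
  assumes sub: "\<And>x y. f x \<ge> f y + g y \<bullet> (x - y)"
    and lip: "L-lipschitz_on UNIV g" and "L > 0"
  shows "(norm (g x - g y))\<^sup>2 \<le> 2 * L * ((g x - g y) \<bullet> (x - y))"
proof -
  have one: "(norm (g x - g y))\<^sup>2 \<le> 4 * L * (f x - f y - g y \<bullet> (x - y))" for x y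
  proof -
    define D where "D = g x - g y"
    \<comment> \<open>The step \<open>1 / (2 L)\<close> maximizes the guaranteed decrease \<open>r (1 - L r) \<parallel>D\<parallel>\<^sup>2\<close> over all steps \<open>r\<close>.\<close>
    define u where "u = x - (1 / (2 * L)) *\<^sub>R D"
    have xu: "x - u = (1 / (2 * L)) *\<^sub>R D" by (simp add: u_def)
    have "norm (g x - g u) \<le> L * norm (x - u)"
      using lip by (auto simp: lipschitz_on_def dist_norm)
    also have "\<dots> = norm D / 2" using \<open>L > 0\<close> by (simp add: xu)
    finally have "(g x - g u) \<bullet> D \<le> norm D / 2 * norm D"
      by (meson norm_cauchy_schwarz mult_right_mono norm_ge_zero order_trans)
    moreover have "norm D / 2 * norm D = (norm D)\<^sup>2 / 2" by (simp add: power2_eq_square)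
    ultimately have near: "(g x - g u) \<bullet> D \<le> (norm D)\<^sup>2 / 2" by simp
    have "g y \<bullet> (u - y) \<le> f u - f y" using sub[of y u] by simp
    moreover have "f u - f x \<le> - (g u \<bullet> (x - u))" using sub[of u x] by simp
    ultimately have "g y \<bullet> (u - y) + g u \<bullet> (x - u) \<le> f x - f y" by linarith
    moreover have "g y \<bullet> (u - y) = g y \<bullet> (x - y) - g y \<bullet> (x - u)"
      by (simp add: inner_diff_right)
    ultimately have "(g u - g y) \<bullet> (x - u) \<le> f x - f y - g y \<bullet> (x - y)"
      by (simp add: inner_diff_left)
    moreover have "(g u - g y) \<bullet> (x - u) = (1 / (2 * L)) * ((norm D)\<^sup>2 - (g x - g u) \<bullet> D)"
      unfolding xu by (simp add: D_def power2_norm_eq_inner inner_diff_left algebra_simps)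
    moreover have "(1 / (2 * L)) * ((norm D)\<^sup>2 - (g x - g u) \<bullet> D) \<ge> (1 / (2 * L)) * ((norm D)\<^sup>2 / 2)"
      using near \<open>L > 0\<close> by (intro mult_left_mono) auto
    ultimately have "(1 / (2 * L)) * ((norm D)\<^sup>2 / 2) \<le> f x - f y - g y \<bullet> (x - y)" by linarith
    then show ?thesis
      using \<open>L > 0\<close> by (simp add: D_def field_simps)
  qed
  have "2 * (norm (g x - g y))\<^sup>2
      \<le> 4 * L * (f x - f y - g y \<bullet> (x - y)) + 4 * L * (f y - f x - g x \<bullet> (y - x))"
    using one[of x y] one[of y x] by (simp add: norm_minus_commute)
  also have "\<dots> = 4 * L * ((g x - g y) \<bullet> (x - y))"
    by (simp add: inner_diff_left inner_diff_right algebra_simps)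
  finally show ?thesis by simp
qed

text \<open>The sum of the strong convexity inequalities at \<open>(x, y)\<close> and \<open>(y, x)\<close>.\<close>

lemma strong_convexity_monotone:
  fixes f :: "'a::real_inner \<Rightarrow> real"
  assumes "\<And>x y. f x \<ge> f y + g y \<bullet> (x - y) + \<mu> / 2 * (norm (y - x))\<^sup>2"
  shows "\<mu> * (norm (x - y))\<^sup>2 \<le> (g x - g y) \<bullet> (x - y)"
  using assms[of x y] assms[of y x]
  by (simp add: norm_minus_commute inner_diff_left inner_diff_right algebra_simps)

section \<open>One inner step, averaged over the index\<close>

text \<open>Here \<open>x\<close> is the current iterate, \<open>z\<close> the snapshot and \<open>s\<close> the stationary point.  The
  deviations \<open>e\<close> stand for \<open>g i x - g i z - A i *v (x - z)\<close>.  After expanding the square,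
  the coefficient of \<open>S = mean (g x) \<bullet> (x - s)\<close> is
  \<open>- 2 \<eta> + 2 \<eta>\<^sup>2 L + 4 \<alpha> \<eta>\<^sup>2 L = - 2 \<eta> (1 - \<eta> L (2 \<alpha> + 1))\<close>, which is negative, so that the lower
  bound on \<open>S\<close> from strong monotonicity may be inserted.\<close>

lemma svrg_step_mean_bound:
  fixes g :: "nat \<Rightarrow> 'a::real_inner \<Rightarrow> 'a" and e :: "nat \<Rightarrow> 'a"
  assumes "n \<ge> 1" "\<eta> > 0" "\<alpha> > 0" "L > 0"
    and cocoercive: "\<And>i x y. i \<in> {1..n} \<Longrightarrow>
          (norm (g i x - g i y))\<^sup>2 \<le> 2 * L * ((g i x - g i y) \<bullet> (x - y))"
    and monotone: "\<And>i x y. i \<in> {1..n} \<Longrightarrow> \<mu> * (norm (x - y))\<^sup>2 \<le> (g i x - g i y) \<bullet> (x - y)"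
    and lip: "\<And>i x y. i \<in> {1..n} \<Longrightarrow> norm (g i x - g i y) \<le> L * norm (x - y)"
    and stationary: "mean n (\<lambda>i. g i s) = 0"
    and step_small: "1 - \<eta> * L * (2 * \<alpha> + 1) > 0"
    and V: "mean n (\<lambda>i. (norm (e i))\<^sup>2) \<le> \<alpha> * mean n (\<lambda>i. (norm (g i x - g i z))\<^sup>2)"
  shows "mean n (\<lambda>i. (norm (x - \<eta> *\<^sub>R (mean n (\<lambda>i. g i x) + (e i - mean n e)) - s))\<^sup>2)
    \<le> (1 - 2 * \<eta> * \<mu> * (1 - \<eta> * L * (2 * \<alpha> + 1))) * (norm (x - s))\<^sup>2
      + 2 * \<alpha> * \<eta>\<^sup>2 * L\<^sup>2 * (norm (z - s))\<^sup>2"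
proof -
  define G where "G = mean n (\<lambda>i. g i x)"
  define S where "S = G \<bullet> (x - s)"
  define d where "d i = G + (e i - mean n e)" for i
  define \<beta> where "\<beta> = 1 - \<eta> * L * (2 * \<alpha> + 1)"
  have G: "G = mean n (\<lambda>i. g i x - g i s)"
    by (simp add: G_def mean_diff stationary)
  have S: "S = mean n (\<lambda>i. (g i x - g i s) \<bullet> (x - s))"
    by (simp add: S_def G mean_inner)
  have at_x: "mean n (\<lambda>i. (norm (g i x - g i s))\<^sup>2) \<le> 2 * L * S"
    unfolding S mean_cmult[symmetric] using cocoercive by (intro mean_mono) auto
  have S_ge: "\<mu> * (norm (x - s))\<^sup>2 \<le> S"
  proof -
    have "mean n (\<lambda>i. \<mu> * (norm (x - s))\<^sup>2) \<le> S"
      unfolding S using monotone by (intro mean_mono) auto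
    then show ?thesis using \<open>n \<ge> 1\<close> by (simp add: mean_const)
  qed
  have at_z: "mean n (\<lambda>i. (norm (g i z - g i s))\<^sup>2) \<le> L\<^sup>2 * (norm (z - s))\<^sup>2"
  proof -
    have "mean n (\<lambda>i. (norm (g i z - g i s))\<^sup>2) \<le> mean n (\<lambda>i. L\<^sup>2 * (norm (z - s))\<^sup>2)"
      using lip by (intro mean_mono) (simp add: power_mono flip: power_mult_distrib)
    then show ?thesis using \<open>n \<ge> 1\<close> by (simp add: mean_const)
  qed
  have "mean n (\<lambda>i. (norm (g i x - g i z))\<^sup>2)
      \<le> mean n (\<lambda>i. 2 * (norm (g i x - g i s))\<^sup>2 + 2 * (norm (g i z - g i s))\<^sup>2)"
  proof (rule mean_mono)
    fix i
    have "norm (g i x - g i z) \<le> norm (g i x - g i s) + norm (g i z - g i s)"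
      using norm_triangle_ineq4[of "g i x - g i s" "g i z - g i s"] by simp
    then have "(norm (g i x - g i z))\<^sup>2 \<le> (norm (g i x - g i s) + norm (g i z - g i s))\<^sup>2"
      by (rule power_mono) simp
    also have "\<dots> \<le> 2 * (norm (g i x - g i s))\<^sup>2 + 2 * (norm (g i z - g i s))\<^sup>2"
      using zero_le_power2[of "norm (g i x - g i s) - norm (g i z - g i s)"]
      by (simp add: power2_eq_square algebra_simps)
    finally show "(norm (g i x - g i z))\<^sup>2
        \<le> 2 * (norm (g i x - g i s))\<^sup>2 + 2 * (norm (g i z - g i s))\<^sup>2" .
  qed
  also have "\<dots> = 2 * mean n (\<lambda>i. (norm (g i x - g i s))\<^sup>2) + 2 * mean n (\<lambda>i. (norm (g i z - g i s))\<^sup>2)"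
    by (simp add: mean_add mean_cmult)
  also have "\<dots> \<le> 4 * L * S + 2 * L\<^sup>2 * (norm (z - s))\<^sup>2"
    using at_x at_z by simp
  finally have drift: "mean n (\<lambda>i. (norm (g i x - g i z))\<^sup>2) \<le> 4 * L * S + 2 * L\<^sup>2 * (norm (z - s))\<^sup>2" .
  have "(norm G)\<^sup>2 \<le> 2 * L * S"
    unfolding G using norm_mean_sq_le[OF \<open>n \<ge> 1\<close>] at_x by (rule order_trans)
  moreover have "mean n (\<lambda>i. (norm (e i))\<^sup>2) \<le> \<alpha> * (4 * L * S + 2 * L\<^sup>2 * (norm (z - s))\<^sup>2)"
    using V drift \<open>\<alpha> > 0\<close> by (meson mult_left_mono less_imp_le order_trans)
  ultimately have second_moment: "mean n (\<lambda>i. (norm (d i))\<^sup>2)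
      \<le> 2 * L * S + \<alpha> * (4 * L * S + 2 * L\<^sup>2 * (norm (z - s))\<^sup>2)"
    using mean_norm_sq_recentre_le[OF \<open>n \<ge> 1\<close>, of G e] unfolding d_def by linarith
  have mean_d: "mean n d = G"
    using \<open>n \<ge> 1\<close> by (simp add: d_def[abs_def] mean_add mean_diff mean_const)
  have "mean n (\<lambda>i. (norm (x - \<eta> *\<^sub>R d i - s))\<^sup>2)
      = mean n (\<lambda>i. (norm ((- \<eta>) *\<^sub>R d i + (x - s)))\<^sup>2)"
    by (simp add: algebra_simps)
  also have "\<dots> = \<eta>\<^sup>2 * mean n (\<lambda>i. (norm (d i))\<^sup>2) - 2 * \<eta> * S + (norm (x - s))\<^sup>2"
    unfolding mean_norm_sq_shift[OF \<open>n \<ge> 1\<close>]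
    by (simp add: mean_linear[of "\<lambda>v. - (\<eta> *\<^sub>R v)", OF linear_compose_neg[OF linear_scaleR]]
        mean_d mean_cmult power_mult_distrib S_def)
  also have "\<dots> \<le> \<eta>\<^sup>2 * (2 * L * S + \<alpha> * (4 * L * S + 2 * L\<^sup>2 * (norm (z - s))\<^sup>2))
      - 2 * \<eta> * S + (norm (x - s))\<^sup>2"
    using second_moment by (simp add: mult_left_mono)
  also have "\<dots> = - (2 * \<eta> * \<beta>) * S + 2 * \<alpha> * \<eta>\<^sup>2 * L\<^sup>2 * (norm (z - s))\<^sup>2 + (norm (x - s))\<^sup>2"
    by (simp add: \<beta>_def power2_eq_square algebra_simps)
  also have "\<dots> \<le> - (2 * \<eta> * \<beta>) * (\<mu> * (norm (x - s))\<^sup>2)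
      + 2 * \<alpha> * \<eta>\<^sup>2 * L\<^sup>2 * (norm (z - s))\<^sup>2 + (norm (x - s))\<^sup>2"
  proof -
    have "(2 * \<eta> * \<beta>) * (\<mu> * (norm (x - s))\<^sup>2) \<le> (2 * \<eta> * \<beta>) * S"
      using S_ge \<open>\<eta> > 0\<close> step_small by (intro mult_left_mono) (auto simp: \<beta>_def)
    then show ?thesis by simp
  qed
  finally show ?thesis
    unfolding d_def G_def \<beta>_def by (simp add: algebra_simps)
qed

section \<open>Conditioning on the past\<close>

text \<open>On each event \<open>X = i\<close> the integrand is the \<open>G\<close>-measurable function \<open>\<Phi> i\<close>, which can be pulled
  out of the conditional expectation; by independence, the conditional probability of that event is
  the constant \<open>1 / n\<close>.\<close>

lemma nn_cond_exp_uniform_index: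
  fixes \<Phi> :: "nat \<Rightarrow> 'w \<Rightarrow> real"
  assumes "prob_space M" "subalgebra M G" "n \<ge> 1"
    and unif: "uniform_independent_of M G n X"
    and meas: "\<And>i. i \<in> {1..n} \<Longrightarrow> \<Phi> i \<in> borel_measurable G"
    and nonneg: "\<And>i \<omega>. 0 \<le> \<Phi> i \<omega>"
  shows "AE \<omega> in M. nn_cond_exp M G (\<lambda>\<omega>. ennreal (\<Phi> (X \<omega>) \<omega>)) \<omega>
           = ennreal (mean n (\<lambda>i. \<Phi> i \<omega>))"
proof -
  interpret prob_space M by fact
  interpret finite_measure_subalgebra M G
    using assms by unfold_locales
  have X: "X \<in> measurable M (count_space {1..n})"
    and distr: "distr M (count_space {1..n}) X = uniform_count_measure {1..n}"
    and indep: "indep_set (sets G) (sets (vimage_algebra (space M) X (count_space {1..n})))"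
    using unif by (auto simp: uniform_independent_of_def)
  define E where "E i = X -` {i} \<inter> space M" for i
  have E_sets: "E i \<in> sets (vimage_algebra (space M) X (count_space {1..n}))" "E i \<in> sets M"
    if "i \<in> {1..n}" for i
    using that X by (auto simp: E_def intro!: in_vimage_algebra measurable_sets)
  have prob_E: "prob (E i) = 1 / real n" if "i \<in> {1..n}" for i
  proof -
    have "prob (E i) = measure (uniform_count_measure {1..n}) {i}"
      unfolding distr[symmetric] E_def by (rule measure_distr[symmetric]) (use that X in auto)
    also have "\<dots> = 1 / real n"
      using that by (simp add: measure_uniform_count_measure)
    finally show ?thesis .
  qed
  have indicator_E: "AE \<omega> in M. ennreal (1 / real n) = nn_cond_exp M G (indicator (E i)) \<omega>"
    if i: "i \<in> {1..n}" for i
  proof (rule nn_cond_exp_charact)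
    fix B assume B: "B \<in> sets G"
    have BM: "B \<in> sets M" using B assms(2) by (auto simp: subalgebra_def)
    have "prob (B \<inter> E i) = prob B * (1 / real n)"
      using indep_setD[OF indep B E_sets(1)[OF i]] prob_E[OF i] by simp
    then have "emeasure M (B \<inter> E i) = ennreal (1 / real n) * emeasure M B"
      by (simp add: emeasure_eq_measure ennreal_mult[symmetric] mult.commute)
    moreover have "(\<integral>\<^sup>+\<omega>\<in>B. indicator (E i) \<omega> \<partial>M) = emeasure M (B \<inter> E i)"
    proof -
      have "(\<integral>\<^sup>+\<omega>\<in>B. indicator (E i) \<omega> \<partial>M) = (\<integral>\<^sup>+\<omega>. indicator (B \<inter> E i) \<omega> \<partial>M)"
        by (intro nn_integral_cong) (auto simp: indicator_def)
      then show ?thesis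
        using E_sets(2)[OF i] BM by simp
    qed
    moreover have "(\<integral>\<^sup>+\<omega>\<in>B. ennreal (1 / real n) \<partial>M) = ennreal (1 / real n) * emeasure M B"
      using BM by (rule nn_integral_cmult_indicator)
    ultimately show "(\<integral>\<^sup>+\<omega>\<in>B. indicator (E i) \<omega> \<partial>M) = (\<integral>\<^sup>+\<omega>\<in>B. ennreal (1 / real n) \<partial>M)"
      by simp
  qed (use E_sets(2)[OF i] in auto)
  have measM: "\<Phi> i \<in> borel_measurable M" if "i \<in> {1..n}" for i
    using meas[OF that] assms(2) by (rule measurable_from_subalg[rotated])
  have partial: "AE \<omega> in M. (\<Sum>i\<in>I. ennreal (\<Phi> i \<omega> * (1 / real n)))
      = nn_cond_exp M G (\<lambda>\<omega>. \<Sum>i\<in>I. ennreal (\<Phi> i \<omega>) * indicator (E i) \<omega>) \<omega>"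
    if "finite I" "I \<subseteq> {1..n}" for I
    using that
  proof (induction I rule: finite_induct)
    case empty
    have "AE \<omega> in M. (0::ennreal) = nn_cond_exp M G (\<lambda>\<omega>. 0) \<omega>"
      by (rule nn_cond_exp_F_meas) simp
    then show ?case by simp
  next
    case (insert j I)
    have j: "j \<in> {1..n}" using insert.prems by auto
    have [measurable]: "\<Phi> j \<in> borel_measurable M" "E j \<in> sets M" using measM E_sets(2) j by auto
    have [measurable]: "(\<lambda>\<omega>. \<Sum>i\<in>I. ennreal (\<Phi> i \<omega>) * indicator (E i) \<omega>) \<in> borel_measurable M"
      using measM E_sets(2) insert.prems by (intro borel_measurable_sum) auto
    have "AE \<omega> in M. ennreal (\<Phi> j \<omega>) * nn_cond_exp M G (indicator (E j)) \<omega>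
        = nn_cond_exp M G (\<lambda>\<omega>. ennreal (\<Phi> j \<omega>) * indicator (E j) \<omega>) \<omega>"
      using meas[OF j] by (intro nn_cond_exp_prod) auto
    moreover have "AE \<omega> in M. nn_cond_exp M G (\<lambda>\<omega>. ennreal (\<Phi> j \<omega>) * indicator (E j) \<omega>) \<omega>
         + nn_cond_exp M G (\<lambda>\<omega>. \<Sum>i\<in>I. ennreal (\<Phi> i \<omega>) * indicator (E i) \<omega>) \<omega>
        = nn_cond_exp M G (\<lambda>\<omega>. ennreal (\<Phi> j \<omega>) * indicator (E j) \<omega>
            + (\<Sum>i\<in>I. ennreal (\<Phi> i \<omega>) * indicator (E i) \<omega>)) \<omega>"
      by (intro nn_cond_exp_sum) auto
    moreover have "AE \<omega> in M. (\<Sum>i\<in>I. ennreal (\<Phi> i \<omega> * (1 / real n)))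
      = nn_cond_exp M G (\<lambda>\<omega>. \<Sum>i\<in>I. ennreal (\<Phi> i \<omega>) * indicator (E i) \<omega>) \<omega>"
      using insert by auto
    ultimately show ?case
      using indicator_E[OF j]
    proof eventually_elim
      case (elim \<omega>)
      have "ennreal (\<Phi> j \<omega> * (1 / real n)) = ennreal (\<Phi> j \<omega>) * ennreal (1 / real n)"
        using nonneg by (intro ennreal_mult) auto
      with elim show ?case
        by (simp only: sum.insert[OF insert.hyps])
    qed
  qed
  have split: "ennreal (\<Phi> (X \<omega>) \<omega>) = (\<Sum>i=1..n. ennreal (\<Phi> i \<omega>) * indicator (E i) \<omega>)"
    if "\<omega> \<in> space M" for \<omega>
  proof -
    have "X \<omega> \<in> {1..n}" using measurable_space[OF X that] by simp
    moreover have "(\<Sum>i=1..n. ennreal (\<Phi> i \<omega>) * indicator (E i) \<omega>)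
        = (\<Sum>i=1..n. if i = X \<omega> then ennreal (\<Phi> i \<omega>) else 0)"
      using that by (intro sum.cong) (auto simp: E_def indicator_def)
    ultimately show ?thesis by simp
  qed
  have sum_meas: "(\<lambda>\<omega>. \<Sum>i=1..n. ennreal (\<Phi> i \<omega>) * indicator (E i) \<omega>) \<in> borel_measurable M"
    using measM E_sets(2) by (intro borel_measurable_sum) auto
  have "AE \<omega> in M. nn_cond_exp M G (\<lambda>\<omega>. ennreal (\<Phi> (X \<omega>) \<omega>)) \<omega>
      = nn_cond_exp M G (\<lambda>\<omega>. \<Sum>i=1..n. ennreal (\<Phi> i \<omega>) * indicator (E i) \<omega>) \<omega>"
    using sum_meas split by (intro nn_cond_exp_cong) (auto cong: measurable_cong)
  moreover have "AE \<omega> in M. (\<Sum>i\<in>{1..n}. ennreal (\<Phi> i \<omega> * (1 / real n)))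
      = nn_cond_exp M G (\<lambda>\<omega>. \<Sum>i=1..n. ennreal (\<Phi> i \<omega>) * indicator (E i) \<omega>) \<omega>"
    by (rule partial) auto
  ultimately show ?thesis
  proof eventually_elim
    case (elim \<omega>)
    have "mean n (\<lambda>i. \<Phi> i \<omega>) = (\<Sum>i=1..n. \<Phi> i \<omega> * (1 / real n))"
      by (simp add: mean_def sum_divide_distrib)
    then show ?case
      using elim nonneg by (simp add: sum_ennreal)
  qed
qed

text \<open>The tower property turns the one-step bound into the recursion \<open>r (t + 1) = q r t + c\<close> for the
  factor in front of \<open>D 0\<close>.  The condition \<open>q * C + c \<le> C\<close> says that \<open>C\<close> is a supersolution of
  this recursion, so \<open>q ^ t + C\<close> dominates \<open>r t\<close> and no geometric sum has to be evaluated.\<close>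

lemma nn_cond_exp_recursion_bound:
  fixes D :: "nat \<Rightarrow> 'w \<Rightarrow> real"
  assumes "prob_space M"
    and sub: "\<And>t. t \<le> m \<Longrightarrow> subalgebra M (G t)"
    and mono: "\<And>t. t \<le> m \<Longrightarrow> sets (G 0) \<subseteq> sets (G t)"
    and D0: "D 0 \<in> borel_measurable (G 0)"
    and D: "\<And>t. t \<le> m \<Longrightarrow> D t \<in> borel_measurable M"
    and nonneg: "\<And>t \<omega>. 0 \<le> D t \<omega>"
    and step: "\<And>t. t < m \<Longrightarrow> AE \<omega> in M.
        nn_cond_exp M (G t) (\<lambda>\<omega>. ennreal (D (Suc t) \<omega>)) \<omega> \<le> ennreal (q * D t \<omega> + c * D 0 \<omega>)"
    and "0 \<le> q" "0 \<le> c" "0 \<le> C" "q * C + c \<le> C"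
    and "t \<le> m"
  shows "AE \<omega> in M. nn_cond_exp M (G 0) (\<lambda>\<omega>. ennreal (D t \<omega>)) \<omega> \<le> ennreal ((q ^ t + C) * D 0 \<omega>)"
  using \<open>t \<le> m\<close>
proof (induction t)
  interpret prob_space M by fact
  interpret finite_measure_subalgebra M "G 0"
    using sub by unfold_locales auto
  {
    case 0
    have "AE \<omega> in M. ennreal (D 0 \<omega>) = nn_cond_exp M (G 0) (\<lambda>\<omega>. ennreal (D 0 \<omega>)) \<omega>"
      using D0 by (intro nn_cond_exp_F_meas) auto
    then show ?case
    proof eventually_elim
      case (elim \<omega>)
      have "D 0 \<omega> \<le> (q ^ 0 + C) * D 0 \<omega>"
        using nonneg[of 0 \<omega>] \<open>0 \<le> C\<close> by (simp add: algebra_simps)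
      then show ?case by (simp add: elim[symmetric] ennreal_leI)
    qed
  next
    case (Suc t)
    have [measurable]: "D 0 \<in> borel_measurable M" "D t \<in> borel_measurable M"
        "D (Suc t) \<in> borel_measurable M"
      using Suc.prems by (auto intro!: D)
    have subt: "subalgebra M (G t)" "subalgebra (G t) (G 0)"
      using Suc.prems sub[of t] sub[of 0] mono[of t] by (auto simp: subalgebra_def)
    have tower: "AE \<omega> in M. nn_cond_exp M (G 0) (\<lambda>\<omega>. ennreal (D (Suc t) \<omega>)) \<omega>
        = nn_cond_exp M (G 0) (nn_cond_exp M (G t) (\<lambda>\<omega>. ennreal (D (Suc t) \<omega>))) \<omega>"
      by (rule nn_cond_exp_nested_subalg[OF subt]) measurable
    have one: "AE \<omega> in M. nn_cond_exp M (G 0) (nn_cond_exp M (G t) (\<lambda>\<omega>. ennreal (D (Suc t) \<omega>))) \<omega>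
        \<le> nn_cond_exp M (G 0) (\<lambda>\<omega>. ennreal q * ennreal (D t \<omega>) + ennreal (c * D 0 \<omega>)) \<omega>"
    proof (rule nn_cond_exp_mono)
      show "AE \<omega> in M. nn_cond_exp M (G t) (\<lambda>\<omega>. ennreal (D (Suc t) \<omega>)) \<omega>
          \<le> ennreal q * ennreal (D t \<omega>) + ennreal (c * D 0 \<omega>)"
        using step[of t] Suc.prems nonneg \<open>0 \<le> q\<close> \<open>0 \<le> c\<close>
        by (simp add: ennreal_mult)
      show "nn_cond_exp M (G t) (\<lambda>\<omega>. ennreal (D (Suc t) \<omega>)) \<in> borel_measurable M"
        by (rule measurable_from_subalg[OF subt(1)]) simp
    qed measurable
    have add: "AE \<omega> in M. nn_cond_exp M (G 0) (\<lambda>\<omega>. ennreal q * ennreal (D t \<omega>)) \<omega>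
          + nn_cond_exp M (G 0) (\<lambda>\<omega>. ennreal (c * D 0 \<omega>)) \<omega>
        = nn_cond_exp M (G 0) (\<lambda>\<omega>. ennreal q * ennreal (D t \<omega>) + ennreal (c * D 0 \<omega>)) \<omega>"
      by (rule nn_cond_exp_sum) measurable
    have scale: "AE \<omega> in M. ennreal q * nn_cond_exp M (G 0) (\<lambda>\<omega>. ennreal (D t \<omega>)) \<omega>
        = nn_cond_exp M (G 0) (\<lambda>\<omega>. ennreal q * ennreal (D t \<omega>)) \<omega>"
      by (rule nn_cond_exp_prod) measurable
    have known: "AE \<omega> in M. ennreal (c * D 0 \<omega>) = nn_cond_exp M (G 0) (\<lambda>\<omega>. ennreal (c * D 0 \<omega>)) \<omega>"
      using D0 by (intro nn_cond_exp_F_meas) auto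
    have "AE \<omega> in M. nn_cond_exp M (G 0) (\<lambda>\<omega>. ennreal (D t \<omega>)) \<omega> \<le> ennreal ((q ^ t + C) * D 0 \<omega>)"
      using Suc by simp
    with tower one add scale known show ?case
    proof eventually_elim
      case (elim \<omega>)
      have "nn_cond_exp M (G 0) (\<lambda>\<omega>. ennreal (D (Suc t) \<omega>)) \<omega>
          \<le> ennreal q * nn_cond_exp M (G 0) (\<lambda>\<omega>. ennreal (D t \<omega>)) \<omega> + ennreal (c * D 0 \<omega>)"
        using elim by simp
      also have "\<dots> \<le> ennreal q * ennreal ((q ^ t + C) * D 0 \<omega>) + ennreal (c * D 0 \<omega>)"
        using elim by (intro add_right_mono mult_left_mono) auto
      also have "\<dots> = ennreal ((q ^ Suc t + (q * C + c)) * D 0 \<omega>)"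
        using nonneg[of 0 \<omega>] \<open>0 \<le> q\<close> \<open>0 \<le> c\<close> \<open>0 \<le> C\<close>
        by (simp add: algebra_simps flip: ennreal_mult ennreal_plus)
      also have "\<dots> \<le> ennreal ((q ^ Suc t + C) * D 0 \<omega>)"
        using nonneg[of 0 \<omega>] \<open>q * C + c \<le> C\<close> by (intro ennreal_leI mult_right_mono) auto
      finally show ?case .
    qed
  }
qed

section \<open>Measurability of the iterates\<close>

lemma borel_measurable_matrix_vector_mult:
  fixes A :: "'w \<Rightarrow> real^'d^'e" and y :: "'w \<Rightarrow> real^'d"
  assumes "A \<in> borel_measurable G" "y \<in> borel_measurable G"
  shows "(\<lambda>\<omega>. A \<omega> *v y \<omega>) \<in> borel_measurable G"
proof (rule borel_measurable_continuous_Pair[OF assms])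
  show "continuous_on UNIV (\<lambda>p :: (real^'d^'e) \<times> (real^'d). fst p *v snd p)"
    unfolding matrix_vector_mult_def
    by (intro continuous_on_vec_lambda continuous_on_sum continuous_intros)
qed

lemma borel_measurable_mean:
  fixes a :: "nat \<Rightarrow> 'w \<Rightarrow> 'a::euclidean_space"
  assumes "\<And>i. i \<in> {1..n} \<Longrightarrow> a i \<in> borel_measurable G"
  shows "(\<lambda>\<omega>. mean n (\<lambda>i. a i \<omega>)) \<in> borel_measurable G"
  unfolding mean_def using assms by (intro borel_measurable_scaleR borel_measurable_sum) auto

lemma borel_measurable_direction:
  assumes grad_meas: "grad (f i) \<in> borel_measurable borel" "grad (objective n f) \<in> borel_measurable borel"
    and A: "\<And>i. i \<in> {1..n} \<Longrightarrow> A i \<in> borel_measurable G"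
    and i: "i \<in> {1..n}"
    and [measurable]: "z \<in> borel_measurable G" "x \<in> borel_measurable G"
  shows "(\<lambda>\<omega>. direction n f (\<lambda>j. A j \<omega>) (z \<omega>) i (x \<omega>)) \<in> borel_measurable G"
proof -
  note [measurable] = grad_meas A[OF i] borel_measurable_matrix_vector_mult borel_measurable_mean[OF A]
  show ?thesis unfolding direction_def by measurable
qed

lemma history_subalgebra_mono:
  assumes "history M m H" "k \<ge> 1" "s \<le> t" "t \<le> m"
  shows "subalgebra (H k t) (H k s)"
  using \<open>s \<le> t\<close> \<open>t \<le> m\<close>
proof (induction t rule: dec_induct)
  case base
  show ?case by (simp add: subalgebra_def)
next
  case (step t)
  have "subalgebra M (H k t)" "subalgebra M (H k (Suc t))"
    using assms step.prems by (auto simp: history_def)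
  moreover have "sets (H k t) \<subseteq> sets (H k (Suc t))"
    using assms step.prems unfolding history_def by (metis One_nat_def atLeastAtMost_iff diff_Suc_1 le_add1 plus_1_eq_Suc)
  ultimately show ?case
    using step by (auto simp: subalgebra_def)
qed

text \<open>The two claims depend on each other: the iterates of an epoch start from the snapshot, and the
  next snapshot is the last iterate.  Hence an induction over the steps, inside an induction over
  the epochs.  A step is a measurable family of maps indexed by the drawn index, whose range is
  countable.\<close>

lemma svrg_run_adapted:
  assumes run: "svrg_run M n f \<eta> m w0 H idx A w snap"
    and grad_meas: "\<And>i. i \<in> {1..n} \<Longrightarrow> grad (f i) \<in> borel_measurable borel"
      "grad (objective n f) \<in> borel_measurable borel"
    and k: "k \<ge> 1"
  shows "snap (k - 1) \<in> borel_measurable (H k 0)"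
    and "t \<le> m \<Longrightarrow> w k t \<in> borel_measurable (H k t)"
proof -
  have hist: "history M m H" using run by (simp add: svrg_run_def)
  then have sub: "subalgebra M (H k t)" if "k \<ge> 1" "t \<le> m" for k t
    using that by (auto simp: history_def)
  then have space_H: "space (H k t) = space M" if "k \<ge> 1" "t \<le> m" for k t
    using that by (auto simp: subalgebra_def)
  have iterate: "w k t \<in> borel_measurable (H k t)"
    if k: "k \<ge> 1" and snap: "snap (k - 1) \<in> borel_measurable (H k 0)" and t: "t \<le> m" for k t
    using t
  proof (induction t)
    case 0
    have "w k 0 \<in> borel_measurable (H k 0) \<longleftrightarrow> snap (k - 1) \<in> borel_measurable (H k 0)"
      by (rule measurable_cong) (use run k space_H[OF k, of 0] in \<open>auto simp: svrg_run_def\<close>)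
    then show ?case using snap by simp
  next
    case (Suc t)
    let ?G = "H k (Suc t)"
    let ?\<Phi> = "\<lambda>i \<omega>. w k t \<omega> - \<eta> *\<^sub>R direction n f (\<lambda>j. A (k - 1) j \<omega>) (snap (k - 1) \<omega>) i (w k t \<omega>)"
    have lift: "h \<in> borel_measurable (H k s) \<Longrightarrow> h \<in> borel_measurable ?G"
      if "s \<le> Suc t" for s and h :: "'a \<Rightarrow> 'c::topological_space"
      using history_subalgebra_mono[OF hist k that Suc.prems] by (rule measurable_from_subalg)
    have "w k t \<in> borel_measurable ?G"
      using Suc.IH Suc.prems by (intro lift[of t]) auto
    moreover have "snap (k - 1) \<in> borel_measurable ?G"
      using snap by (intro lift[of 0]) auto
    moreover have "A (k - 1) i \<in> borel_measurable ?G" if "i \<in> {1..n}" for i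
      using run k that by (intro lift[of 0]) (auto simp: svrg_run_def)
    ultimately have "?\<Phi> i \<in> borel_measurable ?G" if "i \<in> {1..n}" for i
      using that grad_meas by (intro borel_measurable_diff borel_measurable_scaleR
          borel_measurable_direction borel_measurable_const) auto
    moreover have "idx k (Suc t) \<in> measurable ?G (count_space {1..n})"
      using run k Suc.prems by (simp add: svrg_run_def)
    ultimately have "(\<lambda>\<omega>. ?\<Phi> (idx k (Suc t) \<omega>) \<omega>) \<in> borel_measurable ?G"
      by (rule measurable_compose_countable') auto
    moreover have "w k (Suc t) \<in> borel_measurable ?G
        \<longleftrightarrow> (\<lambda>\<omega>. ?\<Phi> (idx k (Suc t) \<omega>) \<omega>) \<in> borel_measurable ?G"
    proof (rule measurable_cong)
      fix \<omega> assume "\<omega> \<in> space ?G"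
      then have \<omega>: "\<omega> \<in> space M" using space_H[OF k Suc.prems] by simp
      have "Suc t \<in> {1..m}" using Suc.prems by simp
      then show "w k (Suc t) \<omega> = ?\<Phi> (idx k (Suc t) \<omega>) \<omega>"
        using run k \<omega> unfolding svrg_run_def by (metis diff_Suc_1)
    qed
    ultimately show ?case by simp
  qed
  have snapshot: "snap j \<in> borel_measurable (H (Suc j) 0)" for j
  proof (induction j)
    case 0
    have "snap 0 \<in> borel_measurable (H (Suc 0) 0) \<longleftrightarrow> (\<lambda>\<omega>. w0) \<in> borel_measurable (H (Suc 0) 0)"
      by (rule measurable_cong) (use run space_H[of 1 0] in \<open>auto simp: svrg_run_def\<close>)
    then show ?case by simp
  next
    case (Suc j)
    have "subalgebra (H (Suc (Suc j)) 0) (H (Suc j) m)"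
      using hist sub[of "Suc j" m] sub[of "Suc (Suc j)" 0] unfolding history_def subalgebra_def by simp
    moreover have "w (Suc j) m \<in> borel_measurable (H (Suc j) m)"
      using Suc by (intro iterate) auto
    ultimately have "w (Suc j) m \<in> borel_measurable (H (Suc (Suc j)) 0)"
      by (rule measurable_from_subalg)
    moreover have "snap (Suc j) \<in> borel_measurable (H (Suc (Suc j)) 0)
        \<longleftrightarrow> w (Suc j) m \<in> borel_measurable (H (Suc (Suc j)) 0)"
      by (rule measurable_cong) (use run space_H[of "Suc (Suc j)" 0] in \<open>auto simp: svrg_run_def\<close>)
    ultimately show ?case by simp
  qed
  show snap_k: "snap (k - 1) \<in> borel_measurable (H k 0)"
    using snapshot[of "k - 1"] k by simp
  show "t \<le> m \<Longrightarrow> w k t \<in> borel_measurable (H k t)"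
    by (rule iterate[OF k snap_k])
qed

section \<open>Contraction over an epoch\<close>

text \<open>As \<open>\<mu> \<le> L\<close> and \<open>\<alpha> > 0\<close>, the subtracted quantity is at most \<open>2 y (1 - y)\<close> with \<open>y = \<eta> L\<close>, hence
  at most one half.  Nonnegativity is what allows the recursion to be iterated.\<close>

lemma svrg_contraction_factor_nonneg:
  fixes \<alpha> \<eta> \<mu> L :: real
  assumes "\<eta> > 0" "\<alpha> > 0" "L > 0" "\<mu> \<le> L" "1 - \<eta> * L * (2 * \<alpha> + 1) > 0"
  shows "0 \<le> 1 - 2 * \<eta> * \<mu> * (1 - \<eta> * L * (2 * \<alpha> + 1))"
proof -
  have "2 * \<eta> * \<mu> * (1 - \<eta> * L * (2 * \<alpha> + 1)) \<le> 2 * \<eta> * L * (1 - \<eta> * L * (2 * \<alpha> + 1))"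
    using assms by (intro mult_right_mono mult_left_mono) auto
  also have "\<dots> \<le> 2 * \<eta> * L * (1 - \<eta> * L)"
    using assms by (intro mult_left_mono) (auto simp: algebra_simps)
  also have "\<dots> \<le> 1"
    using zero_le_power2[of "1 - 2 * (\<eta> * L)"] by (simp add: power2_eq_square algebra_simps)
  finally show ?thesis by simp
qed

theorem theorem4p2:
  fixes M :: "'w measure"
    and n m :: nat
    and f :: "nat \<Rightarrow> real^'d \<Rightarrow> real"
    and \<mu>s :: "nat \<Rightarrow> real"
    and L \<mu> \<eta> \<alpha> \<gamma> :: real
    and w0 wstar :: "real^'d"
    and H :: "nat \<Rightarrow> nat \<Rightarrow> 'w measure"
    and idx :: "nat \<Rightarrow> nat \<Rightarrow> 'w \<Rightarrow> nat"
    and A :: "nat \<Rightarrow> nat \<Rightarrow> 'w \<Rightarrow> real^'d^'d"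
    and w :: "nat \<Rightarrow> nat \<Rightarrow> 'w \<Rightarrow> real^'d"
    and snap :: "nat \<Rightarrow> 'w \<Rightarrow> real^'d"
  assumes "prob_space M"
    and "n \<ge> 1" and "m \<ge> 1" and "\<eta> > 0" and "\<alpha> > 0"
    and "\<forall>i\<in>{1..n}. twice_continuously_differentiable (f i)"
    and "strongly_convex_and_smooth n f \<mu>s L"
    and "\<mu> = Min (\<mu>s ` {1..n})"
    and "svrg_run M n f \<eta> m w0 H idx A w snap"
    and "variance_condition M f m \<alpha> H idx A w snap"
    and "\<forall>z. objective n f wstar \<le> objective n f z"
    and "\<gamma> = (1 - 2 * \<eta> * \<mu> * (1 - \<eta> * L * (2 * \<alpha> + 1))) ^ m
             + 2 * \<alpha> * \<eta> * L\<^sup>2 / (\<mu> * (1 - \<eta> * L * (2 * \<alpha> + 1)))"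
    and "1 - \<eta> * L * (2 * \<alpha> + 1) > 0"
  shows "\<forall>k\<ge>1. AE \<omega> in M.
           nn_cond_exp M (H k 0) (\<lambda>\<omega>. ennreal ((norm (snap k \<omega> - wstar))\<^sup>2)) \<omega>
           \<le> ennreal (\<gamma> * (norm (snap (k - 1) \<omega> - wstar))\<^sup>2)"
proof (intro allI impI)
  fix k :: nat assume k: "k \<ge> 1"
  interpret prob_space M by fact
  note run = \<open>svrg_run M n f \<eta> m w0 H idx A w snap\<close>
  define g where "g i = grad (f i)" for i
  define q where "q = 1 - 2 * \<eta> * \<mu> * (1 - \<eta> * L * (2 * \<alpha> + 1))"
  define c where "c = 2 * \<alpha> * \<eta>\<^sup>2 * L\<^sup>2"
  define C where "C = 2 * \<alpha> * \<eta> * L\<^sup>2 / (\<mu> * (1 - \<eta> * L * (2 * \<alpha> + 1)))"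
  have \<gamma>: "\<gamma> = q ^ m + C" using assms by (simp add: q_def C_def)

  have "L > 0"
    and lipschitz: "\<And>i. i \<in> {1..n} \<Longrightarrow> L-lipschitz_on UNIV (g i)"
    and \<mu>s_pos: "\<And>i. i \<in> {1..n} \<Longrightarrow> \<mu>s i > 0"
    and strong: "\<And>i x y. i \<in> {1..n} \<Longrightarrow>
      f i x \<ge> f i y + g i y \<bullet> (x - y) + \<mu>s i / 2 * (norm (y - x))\<^sup>2"
    using assms(7) by (auto simp: strongly_convex_and_smooth_def g_def)
  have lip: "norm (g i x - g i y) \<le> L * norm (x - y)" if "i \<in> {1..n}" for i x y
    using lipschitz[OF that] by (auto simp: lipschitz_on_def dist_norm)
  have \<mu>_le: "\<mu> \<le> \<mu>s i" if "i \<in> {1..n}" for i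
    using that assms(8) by simp
  have "\<mu> \<in> \<mu>s ` {1..n}" using assms(8) \<open>n \<ge> 1\<close> by (simp add: Min_in)
  then have "\<mu> > 0" using \<mu>s_pos by auto
  have monotone: "\<mu> * (norm (x - y))\<^sup>2 \<le> (g i x - g i y) \<bullet> (x - y)" if "i \<in> {1..n}" for i x y
  proof -
    have "\<mu> * (norm (x - y))\<^sup>2 \<le> \<mu>s i * (norm (x - y))\<^sup>2"
      using \<mu>_le[OF that] by (intro mult_right_mono) auto
    also have "\<dots> \<le> (g i x - g i y) \<bullet> (x - y)"
      using strong[OF that] by (rule strong_convexity_monotone)
    finally show ?thesis .
  qed
  have cocoercive: "(norm (g i x - g i y))\<^sup>2 \<le> 2 * L * ((g i x - g i y) \<bullet> (x - y))"
    if "i \<in> {1..n}" for i x y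
  proof (rule lipschitz_subgradient_cocoercive[OF _ lipschitz[OF that] \<open>L > 0\<close>])
    fix x y :: "real^'d"
    have "0 \<le> \<mu>s i / 2 * (norm (y - x))\<^sup>2" using \<mu>s_pos[OF that] by simp
    then show "f i x \<ge> f i y + g i y \<bullet> (x - y)"
      using strong[OF that, of y x] by linarith
  qed
  have deriv: "GDERIV (f i) x :> g i x" if "i \<in> {1..n}" for i x
    using that assms(6) by (simp add: GDERIV_grad g_def)
  have grad_obj: "grad (objective n f) x = mean n (\<lambda>i. g i x)" for x
    using deriv unfolding g_def by (rule grad_objective)
  have stationary: "mean n (\<lambda>i. g i wstar) = 0"
    by (rule GDERIV_minimum_eq_0[OF GDERIV_objective]) (use deriv assms(11) in auto)

  have "\<mu> \<le> L"
  proof -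
    obtain u :: "real^'d" where u: "norm u = 1" using vector_choose_size[of 1] by auto
    have 1: "1 \<in> {1..n}" using \<open>n \<ge> 1\<close> by simp
    have "\<mu> \<le> (g 1 u - g 1 0) \<bullet> u" using monotone[OF 1, of u 0] u by simp
    also have "\<dots> \<le> norm (g 1 u - g 1 0)" using norm_cauchy_schwarz[of "g 1 u - g 1 0" u] u by simp
    also have "\<dots> \<le> L" using lip[OF 1, of u 0] u by simp
    finally show ?thesis .
  qed
  then have "0 \<le> q"
    unfolding q_def using assms \<open>L > 0\<close> by (intro svrg_contraction_factor_nonneg) auto
  have "0 \<le> c" using assms by (simp add: c_def)
  have "0 \<le> C" using assms \<open>\<mu> > 0\<close> unfolding C_def by (intro divide_nonneg_pos) auto
  \<comment> \<open>\<open>(1 - q) * C = c\<close> would be the fixed point; the constant \<open>C\<close> in \<open>\<gamma>\<close> is twice as large.\<close>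
  have "q * C + c \<le> C"
  proof -
    have "(1 - q) * C = 2 * c"
      using \<open>\<mu> > 0\<close> assms(13) by (simp add: q_def C_def c_def power2_eq_square)
    then show ?thesis using \<open>0 \<le> c\<close> by (simp add: algebra_simps)
  qed

  have hist: "history M m H" using run by (simp add: svrg_run_def)
  then have sub: "subalgebra M (H k t)" if "t \<le> m" for t
    using that k by (auto simp: history_def)
  have g_meas: "g i \<in> borel_measurable borel" if "i \<in> {1..n}" for i
    using lipschitz_on_continuous_on[OF lipschitz[OF that]] by (rule borel_measurable_continuous_onI)
  have obj_meas: "grad (objective n f) \<in> borel_measurable borel"
    unfolding grad_obj[abs_def] by (rule borel_measurable_mean[OF g_meas])
  have adapted: "snap (k - 1) \<in> borel_measurable (H k 0)"
    "\<And>t. t \<le> m \<Longrightarrow> w k t \<in> borel_measurable (H k t)"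
    by (rule svrg_run_adapted[OF run _ obj_meas k]; use g_meas in \<open>simp add: g_def\<close>)+

  define D where "D t \<omega> = (norm (w k t \<omega> - wstar))\<^sup>2" for t \<omega>
  have D_meas: "D t \<in> borel_measurable (H k t)" if "t \<le> m" for t
    unfolding D_def[abs_def] using adapted(2)[OF that] by measurable
  have D_meas_M: "D t \<in> borel_measurable M" if "t \<le> m" for t
    using sub[OF that] D_meas[OF that] by (rule measurable_from_subalg)
  have snap_prev: "w k 0 \<omega> = snap (k - 1) \<omega>" and snap_next: "snap k \<omega> = w k m \<omega>"
    if "\<omega> \<in> space M" for \<omega>
    using run k that by (auto simp: svrg_run_def)

  have step: "AE \<omega> in M. nn_cond_exp M (H k t) (\<lambda>\<omega>. ennreal (D (Suc t) \<omega>)) \<omega>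
      \<le> ennreal (q * D t \<omega> + c * D 0 \<omega>)" if t: "t < m" for t
  proof -
    interpret sigma_finite_subalgebra M "H k t"
      using sub[of t] t by (intro finite_measure_subalgebra_is_sigma_finite)
        (unfold_locales, auto)
    let ?x = "w k t" and ?z = "snap (k - 1)" and ?X = "idx k (Suc t)"
    let ?B = "\<lambda>\<omega> j. A (k - 1) j \<omega>"
    define e where "e i \<omega> = g i (?x \<omega>) - g i (?z \<omega>) - A (k - 1) i \<omega> *v (?x \<omega> - ?z \<omega>)" for i \<omega>
    define \<Phi> where "\<Phi> i \<omega> = (norm (?x \<omega> - \<eta> *\<^sub>R direction n f (?B \<omega>) (?z \<omega>) i (?x \<omega>) - wstar))\<^sup>2" for i \<omega>
    have St: "Suc t \<in> {1..m}" using t by simp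
    have unif: "uniform_independent_of M (H k t) n ?X"
    proof -
      have "\<forall>k\<ge>1. \<forall>t\<in>{1..m}. uniform_independent_of M (H k (t - 1)) n (idx k t)"
        using run unfolding svrg_run_def by blast
      from this[rule_format, OF k St] show ?thesis by simp
    qed
    have lift: "h \<in> borel_measurable (H k 0) \<Longrightarrow> h \<in> borel_measurable (H k t)"
      for h :: "'w \<Rightarrow> 'b::topological_space"
      using history_subalgebra_mono[OF hist k, of 0 t] t by (auto intro: measurable_from_subalg)
    have x_meas [measurable]: "?x \<in> borel_measurable (H k t)" using adapted(2)[of t] t by simp
    have z_meas [measurable]: "?z \<in> borel_measurable (H k t)" using adapted(1) by (rule lift)
    have A_meas: "A (k - 1) i \<in> borel_measurable (H k t)" if "i \<in> {1..n}" for i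
      using run k that by (intro lift) (auto simp: svrg_run_def)
    have gx_meas: "(\<lambda>\<omega>. g i (?x \<omega>)) \<in> borel_measurable (H k t)"
      and gz_meas: "(\<lambda>\<omega>. g i (?z \<omega>)) \<in> borel_measurable (H k t)" if "i \<in> {1..n}" for i
      using g_meas[OF that] by measurable
    have e_meas: "e i \<in> borel_measurable (H k t)" if "i \<in> {1..n}" for i
      unfolding e_def[abs_def]
      by (intro borel_measurable_diff borel_measurable_matrix_vector_mult
          gx_meas gz_meas A_meas x_meas z_meas that)
    have \<Phi>_nonneg: "0 \<le> \<Phi> i \<omega>" for i \<omega> by (simp add: \<Phi>_def)
    have \<Phi>_meas: "\<Phi> i \<in> borel_measurable (H k t)" if "i \<in> {1..n}" for i
    proof -
      have [measurable]: "(\<lambda>\<omega>. direction n f (?B \<omega>) (?z \<omega>) i (?x \<omega>)) \<in> borel_measurable (H k t)"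
        using g_meas[OF that] obj_meas A_meas x_meas z_meas that
        by (intro borel_measurable_direction) (auto simp: g_def)
      show ?thesis unfolding \<Phi>_def[abs_def] by measurable
    qed

    have "AE \<omega> in M. nn_cond_exp M (H k t) (\<lambda>\<omega>. ennreal ((norm (e (?X \<omega>) \<omega>))\<^sup>2)) \<omega>
        \<le> ennreal \<alpha> * nn_cond_exp M (H k t) (\<lambda>\<omega>. ennreal ((norm (g (?X \<omega>) (?x \<omega>) - g (?X \<omega>) (?z \<omega>)))\<^sup>2)) \<omega>"
      using assms(10)[unfolded variance_condition_def, rule_format, OF k St]
      by (simp only: e_def g_def diff_Suc_1)
    moreover have "AE \<omega> in M. nn_cond_exp M (H k t) (\<lambda>\<omega>. ennreal ((norm (e (?X \<omega>) \<omega>))\<^sup>2)) \<omega>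
        = ennreal (mean n (\<lambda>i. (norm (e i \<omega>))\<^sup>2))"
      by (rule nn_cond_exp_uniform_index[OF \<open>prob_space M\<close> subalg \<open>n \<ge> 1\<close> unif,
            of "\<lambda>i \<omega>. (norm (e i \<omega>))\<^sup>2"]) (use e_meas in auto)
    moreover have "AE \<omega> in M. nn_cond_exp M (H k t)
          (\<lambda>\<omega>. ennreal ((norm (g (?X \<omega>) (?x \<omega>) - g (?X \<omega>) (?z \<omega>)))\<^sup>2)) \<omega>
        = ennreal (mean n (\<lambda>i. (norm (g i (?x \<omega>) - g i (?z \<omega>)))\<^sup>2))"
      by (rule nn_cond_exp_uniform_index[OF \<open>prob_space M\<close> subalg \<open>n \<ge> 1\<close> unif,
            of "\<lambda>i \<omega>. (norm (g i (?x \<omega>) - g i (?z \<omega>)))\<^sup>2"]) (use gx_meas gz_meas in auto)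
    moreover have "AE \<omega> in M. nn_cond_exp M (H k t) (\<lambda>\<omega>. ennreal (\<Phi> (?X \<omega>) \<omega>)) \<omega>
        = ennreal (mean n (\<lambda>i. \<Phi> i \<omega>))"
      by (rule nn_cond_exp_uniform_index[OF \<open>prob_space M\<close> subalg \<open>n \<ge> 1\<close> unif])
         (use \<Phi>_meas \<Phi>_nonneg in auto)
    moreover have "AE \<omega> in M. nn_cond_exp M (H k t) (\<lambda>\<omega>. ennreal (D (Suc t) \<omega>)) \<omega>
        = nn_cond_exp M (H k t) (\<lambda>\<omega>. ennreal (\<Phi> (?X \<omega>) \<omega>)) \<omega>"
    proof -
      have eq: "D (Suc t) \<omega> = \<Phi> (?X \<omega>) \<omega>" if "\<omega> \<in> space M" for \<omega>
      proof -
        have "w k (Suc t) \<omega> = ?x \<omega> - \<eta> *\<^sub>R direction n f (?B \<omega>) (?z \<omega>) (?X \<omega>) (?x \<omega>)"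
          using run k that St unfolding svrg_run_def by (metis diff_Suc_1)
        then show ?thesis by (simp add: D_def \<Phi>_def)
      qed
      have "D (Suc t) \<in> borel_measurable M" using t by (intro D_meas_M) simp
      moreover from this have "(\<lambda>\<omega>. \<Phi> (?X \<omega>) \<omega>) \<in> borel_measurable M"
        using eq by (simp cong: measurable_cong)
      ultimately show ?thesis
        using eq by (intro nn_cond_exp_cong) auto
    qed
    ultimately show ?thesis
      using AE_space
    proof eventually_elim
      case (elim \<omega>)
      have "mean n (\<lambda>i. (norm (e i \<omega>))\<^sup>2) \<le> \<alpha> * mean n (\<lambda>i. (norm (g i (?x \<omega>) - g i (?z \<omega>)))\<^sup>2)"
        using elim(1) \<open>\<alpha> > 0\<close> unfolding elim(2,3)
        by (simp add: mean_nonneg ennreal_le_iff flip: ennreal_mult)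
      then have bound: "mean n (\<lambda>i. (norm (?x \<omega> - \<eta> *\<^sub>R (mean n (\<lambda>i. g i (?x \<omega>))
            + (e i \<omega> - mean n (\<lambda>i. e i \<omega>))) - wstar))\<^sup>2)
          \<le> q * (norm (?x \<omega> - wstar))\<^sup>2 + c * (norm (?z \<omega> - wstar))\<^sup>2"
        unfolding q_def c_def using assms \<open>L > 0\<close> cocoercive monotone lip stationary
        by (intro svrg_step_mean_bound) auto
      have dir: "direction n f (?B \<omega>) (?z \<omega>) i (?x \<omega>)
          = mean n (\<lambda>i. g i (?x \<omega>)) + (e i \<omega> - mean n (\<lambda>i. e i \<omega>))" for i
        by (simp add: direction_def e_def grad_obj mean_diff mean_matrix_vector_mult
            matrix_vector_mult_diff_rdistrib g_def)
      have "mean n (\<lambda>i. \<Phi> i \<omega>) \<le> q * D t \<omega> + c * D 0 \<omega>"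
        using bound snap_prev[OF elim(6)] unfolding \<Phi>_def dir by (simp add: D_def)
      then show ?case using elim by (simp add: ennreal_leI)
    qed
  qed

  have "AE \<omega> in M. nn_cond_exp M (H k 0) (\<lambda>\<omega>. ennreal (D m \<omega>)) \<omega> \<le> ennreal ((q ^ m + C) * D 0 \<omega>)"
  proof (rule nn_cond_exp_recursion_bound[where m = m and G = "H k" and c = c])
    show "sets (H k 0) \<subseteq> sets (H k t)" if "t \<le> m" for t
      using history_subalgebra_mono[OF hist k _ that, of 0] by (simp add: subalgebra_def)
    show "0 \<le> D t \<omega>" for t \<omega> by (simp add: D_def)
  qed (use \<open>prob_space M\<close> sub D_meas D_meas_M step \<open>0 \<le> q\<close> \<open>0 \<le> c\<close> \<open>0 \<le> C\<close> \<open>q * C + c \<le> C\<close>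
      in auto)
  moreover have "AE \<omega> in M. nn_cond_exp M (H k 0) (\<lambda>\<omega>. ennreal ((norm (snap k \<omega> - wstar))\<^sup>2)) \<omega>
      = nn_cond_exp M (H k 0) (\<lambda>\<omega>. ennreal (D m \<omega>)) \<omega>"
  proof -
    interpret sigma_finite_subalgebra M "H k 0"
      using sub[of 0] by (intro finite_measure_subalgebra_is_sigma_finite)
        (unfold_locales, auto)
    have eq: "(norm (snap k \<omega> - wstar))\<^sup>2 = D m \<omega>" if "\<omega> \<in> space M" for \<omega>
      using snap_next[OF that] by (simp add: D_def)
    have "(\<lambda>\<omega>. (norm (snap k \<omega> - wstar))\<^sup>2) \<in> borel_measurable M"
      using D_meas_M[of m] eq by (simp cong: measurable_cong)
    then show ?thesis
      using D_meas_M[of m] eq by (intro nn_cond_exp_cong) auto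
  qed
  ultimately show "AE \<omega> in M. nn_cond_exp M (H k 0) (\<lambda>\<omega>. ennreal ((norm (snap k \<omega> - wstar))\<^sup>2)) \<omega>
      \<le> ennreal (\<gamma> * (norm (snap (k - 1) \<omega> - wstar))\<^sup>2)"
    using AE_space
  proof eventually_elim
    case (elim \<omega>)
    then show ?case by (simp add: \<gamma> D_def snap_prev)
  qed
qed

end
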